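(* Let $p<q$ be integers. Consider the vector bundles $F=\mathcal{O}_{\mathbb{P}^N}^{m}$ and $G=\mathcal{O}_{\mathbb{P}^N}(p)^{\oplus a}\oplus\mathcal{O}_{\mathbb{P}^N}(q)^{\oplus (n-a)}$ on $\mathbb{P}^N$. Let $f:F\to G$ be a general map, let $f':F\to\mathcal{O}_{\mathbb{P}^N}(p)^{\oplus a}$ be the induced map, let $\Delta_t(f)=\{x\in\mathbb{P}^N\mid \operatorname{rank} f_x<t\}$ be the degeneracy locus (and similarly $\Delta_r(f')=\{x\in\mathbb{P}^N\mid\operatorname{rank} f'_x<r\}$), and let $\Delta_t(f)_{\le d}$ be the locus defined by the ideal $I(\Delta_t(f))_{\le d}$. Then $$\Delta_t(f)_{\le d}=\Delta_t(f)\cup\Delta_r(f')\qquad\text{for } r=\left\lceil\frac{tq-d}{q-p}\right\rceil .$$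
   Context: $\mathbb{P}^N$ is projective space over a field. The induced map $f'$ is the composition of $f$ with the projection of $G$ onto $\mathcal{O}_{\mathbb{P}^N}(p)^{\oplus a}$. The map $f$ is given by an $m\times n$ matrix of homogeneous forms, with entries of degree $p$ in the first $a$ columns and of degree $q$ in the remaining columns; $I(\Delta_t(f))$ denotes the homogeneous ideal generated by the $t\times t$ minors of this matrix. For a homogeneous ideal $I$, $I_{\le d}$ denotes the ideal generated by the forms in $I$ of degree $\le d$. $f_x$ is the map induced by $f$ on fibers at $x$. "General" means for all $f$ in some nonempty Zariski open subset of $\operatorname{Hom}(F,G)$.
   Formalization: The formal statement assumes tp ≤ d (so r ≤ t). For d < tp the ideal I(Δ_t(f))_{≤d} is zero, and the formula is false (p=1, q=2, m=n=a=2, t=1, d=0) or reads P^N = P^N. *)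

theory Defs
  imports
    "HOL-Library.Poly_Mapping"
    "Jordan_Normal_Form.Ring_Hom_Matrix"
    "Jordan_Normal_Form.DL_Rank_Submatrix"
begin

text \<open>
  The homogeneous coordinate ring of \<open>\<PP>\<^sup>N\<close> over a field \<open>'k\<close> is the polynomial ring in the
  variables \<open>'v\<close>, a finite type with \<open>N + 1\<close> elements; a polynomial maps exponent vectors
  (monomials) to coefficients.
\<close>

type_synonym ('v, 'k) mpoly = "('v \<Rightarrow>\<^sub>0 nat) \<Rightarrow>\<^sub>0 'k"

text \<open>Evaluation at a point whose coordinates lie in an extension \<open>\<iota> : 'k \<rightarrow> 'l\<close> of the base field.\<close>

definition mpoly_eval ::
    "('k::comm_ring_1 \<Rightarrow> 'l::comm_ring_1) \<Rightarrow> ('v \<Rightarrow> 'l) \<Rightarrow> ('v, 'k) mpoly \<Rightarrow> 'l" where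
  "mpoly_eval \<iota> x g =
     (\<Sum>\<mu>\<in>Poly_Mapping.keys g. \<iota> (Poly_Mapping.lookup g \<mu>) *
        (\<Prod>v\<in>Poly_Mapping.keys \<mu>. x v ^ Poly_Mapping.lookup \<mu> v))"

definition mono_degree :: "('v \<Rightarrow>\<^sub>0 nat) \<Rightarrow> nat" where
  "mono_degree \<mu> = (\<Sum>v\<in>Poly_Mapping.keys \<mu>. Poly_Mapping.lookup \<mu> v)"

text \<open>Degrees are integers; the only form of negative degree is \<open>0\<close>.\<close>

definition is_form :: "int \<Rightarrow> ('v, 'k::zero) mpoly \<Rightarrow> bool" where
  "is_form e g \<longleftrightarrow> (\<forall>\<mu>\<in>Poly_Mapping.keys g. int (mono_degree \<mu>) = e)"

definition ideal_gen :: "'r::comm_ring_1 set \<Rightarrow> 'r set" where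
  "ideal_gen B = Modules.module.span (*) B"

definition ideal_le :: "int \<Rightarrow> ('v, 'k::comm_ring_1) mpoly set \<Rightarrow> ('v, 'k) mpoly set" where
  "ideal_le d I = ideal_gen {g \<in> I. \<exists>e\<le>d. is_form e g}"

definition minors :: "nat \<Rightarrow> 'r::comm_ring_1 mat \<Rightarrow> 'r set" where
  "minors t A = {det (submatrix A R C) | R C.
     R \<subseteq> {..<dim_row A} \<and> C \<subseteq> {..<dim_col A} \<and> card R = t \<and> card C = t}"

definition minor_ideal :: "nat \<Rightarrow> 'r::comm_ring_1 mat \<Rightarrow> 'r set" where
  "minor_ideal t A = ideal_gen (minors t A)"

text \<open>
  A map \<open>F \<rightarrow> G\<close> from \<open>F = \<O>\<^sup>m\<close> to \<open>G = \<O>(p)\<^sup>a \<oplus> \<O>(q)\<^sup>n\<^sup>-\<^sup>a\<close> is an \<open>m \<times> n\<close> matrix of forms whose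
  columns correspond to the summands of \<open>G\<close>.
\<close>

definition bundle_maps ::
    "nat \<Rightarrow> nat \<Rightarrow> nat \<Rightarrow> int \<Rightarrow> int \<Rightarrow> ('v, 'k::zero) mpoly mat set" where
  "bundle_maps m n a p q = {f \<in> carrier_mat m n.
     \<forall>i<m. \<forall>j<n. is_form (if j < a then p else q) (f $$ (i, j))}"

definition first_columns :: "nat \<Rightarrow> 'r mat \<Rightarrow> 'r mat" where
  "first_columns a f = mat (dim_row f) a (\<lambda>(i, j). f $$ (i, j))"

text \<open>
  The \<open>'l\<close>-valued points of \<open>\<PP>\<^sup>N\<close>. A point is the class of its homogeneous coordinate vectors.
  Taking for \<open>'l\<close> the base field gives the rational points, and taking an algebraically closed
  extension gives the geometric points (and, if its transcendence degree is at least \<open>N\<close>, reaches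
  all points of the scheme).
\<close>

definition proj_space :: "('v \<Rightarrow> 'l::field) set set" where
  "proj_space = {{(\<lambda>v. c * x v) | c. c \<noteq> 0} | x. \<exists>v. x v \<noteq> 0}"

definition vanishing_locus ::
    "('k::field \<Rightarrow> 'l::field) \<Rightarrow> ('v, 'k) mpoly set \<Rightarrow> ('v \<Rightarrow> 'l) set set" where
  "vanishing_locus \<iota> I = {X \<in> proj_space. \<forall>x\<in>X. \<forall>g\<in>I. mpoly_eval \<iota> x g = 0}"

text \<open>
  In the trivialisations of the fibres of the summands of \<open>G\<close> given by a homogeneous coordinate
  vector \<open>x\<close>, the map on fibres is the matrix of values at \<open>x\<close>; another choice of \<open>x\<close> rescales each
  column by a unit.
\<close>

definition fibre_map ::
    "('k::field \<Rightarrow> 'l::field) \<Rightarrow> ('v, 'k) mpoly mat \<Rightarrow> ('v \<Rightarrow> 'l) \<Rightarrow> 'l mat" where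
  "fibre_map \<iota> f x = map_mat (mpoly_eval \<iota> x) f"

definition degeneracy_locus ::
    "('k::field \<Rightarrow> 'l::field) \<Rightarrow> int \<Rightarrow> ('v, 'k) mpoly mat \<Rightarrow> ('v \<Rightarrow> 'l) set set" where
  "degeneracy_locus \<iota> s f = {X \<in> proj_space.
     \<forall>x\<in>X. int (vec_space.rank (dim_row f) (fibre_map \<iota> f x)) < s}"

text \<open>
  Coordinates on the finite-dimensional vector space \<open>Hom(F, G)\<close>: the coefficient of the monomial
  \<open>\<mu>\<close> in the entry \<open>(i, j)\<close>. Indices outside the matrix, and monomials of the wrong degree, only
  contribute coordinates that vanish identically on \<open>Hom(F, G)\<close>, so they do not affect which sets
  are closed.
\<close>

definition coeff_coords ::
    "('v, 'k::zero) mpoly mat \<Rightarrow> nat \<times> nat \<times> ('v \<Rightarrow>\<^sub>0 nat) \<Rightarrow> 'k" where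
  "coeff_coords f = (\<lambda>(i, j, \<mu>).
     if i < dim_row f \<and> j < dim_col f then Poly_Mapping.lookup (f $$ (i, j)) \<mu> else 0)"

definition zariski_open_in ::
    "('v, 'k::field) mpoly mat set \<Rightarrow> ('v, 'k) mpoly mat set \<Rightarrow> bool" where
  "zariski_open_in V U \<longleftrightarrow>
     (\<exists>H :: (nat \<times> nat \<times> ('v \<Rightarrow>\<^sub>0 nat), 'k) mpoly set.
        U = {f \<in> V. \<exists>h\<in>H. mpoly_eval id (coeff_coords f) h \<noteq> 0})"

definition for_general ::
    "('v, 'k::field) mpoly mat set \<Rightarrow> (('v, 'k) mpoly mat \<Rightarrow> bool) \<Rightarrow> bool" where
  "for_general V P \<longleftrightarrow> (\<exists>U. zariski_open_in V U \<and> U \<noteq> {} \<and> (\<forall>f\<in>U. P f))"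

end

theory Submission
  imports Defs
begin

text \<open>
  The open set of maps is all of \<open>Hom(F, G)\<close>: the identity of loci holds for each \<open>f\<close>, because it
  reduces to linear algebra at each point.

  A \<open>t\<close>-minor of \<open>f\<close> that uses \<open>c\<close> of the first \<open>a\<close> columns is a form of degree
  \<open>c p + (t - c) q = t q - c (q - p)\<close>, so its degree is at most \<open>d\<close> exactly when \<open>c \<ge> r\<close>
  (\<open>is_form_minor\<close>). A form of degree \<open>e\<close> in the ideal of minors is a combination of
  minors of degree at most \<open>e\<close>, since the contributions of the other minors live in higher
  degrees. Hence \<open>I(\<Delta>\<^sub>t(f))\<^sub>\<le>\<^sub>d\<close> and the set of \<open>t\<close>-minors with at least \<open>r\<close> of the
  first \<open>a\<close> columns have the same zeros (\<open>ideal_le_ideal_gen_vanishes\<close>).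

  At a point, let \<open>A\<close> be the matrix of values of \<open>f\<close>, with first \<open>a\<close> columns \<open>A'\<close>. If
  \<open>rank A \<ge> t\<close> and \<open>rank A' \<ge> r\<close>, then \<open>r\<close> independent columns of \<open>A'\<close> extend to \<open>t\<close>
  independent columns of \<open>A\<close>, and these carry a nonzero minor; \<open>t p \<le> d\<close> enters here, in the form
  \<open>r \<le> t\<close>. Conversely, a nonzero minor with at least \<open>r\<close> of the first \<open>a\<close> columns forces both
  rank bounds (\<open>minors_with_first_columns_vanish_iff\<close>). So all these minors vanish at the point
  if and only if \<open>rank A < t\<close> or \<open>rank A' < r\<close>.

  The loci consist of classes of coordinate vectors. Since minors are forms, both ranks are
  constant on a class (\<open>rank_fibre_map_scale\<close>), and so the same one of the two alternatives
  can be chosen for all its representatives.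
\<close>

section \<open>Generated ideals\<close>

lemma module_mult: "Modules.module ((*) :: 'r::comm_ring_1 \<Rightarrow> 'r \<Rightarrow> 'r)"
  by unfold_locales (simp_all add: algebra_simps)

lemma subset_ideal_gen: "S \<subseteq> ideal_gen S"
  unfolding ideal_gen_def by (rule Modules.module.span_superset[OF module_mult])

lemma ideal_gen_induct [consumes 1, case_names gen zero add mult]:
  assumes "g \<in> ideal_gen S"
    and "\<And>s. s \<in> S \<Longrightarrow> P s" "P 0" "\<And>g h. P g \<Longrightarrow> P h \<Longrightarrow> P (g + h)" "\<And>c g. P g \<Longrightarrow> P (c * g)"
  shows "P g"
proof -
  have "Modules.module.subspace (*) {g. P g}"
    using assms(3-5) by (auto simp: Modules.module.subspace_def[OF module_mult])
  then have "Modules.module.span (*) S \<subseteq> {g. P g}"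
    using assms(2) by (intro Modules.module.span_minimal[OF module_mult]) auto
  then show ?thesis
    using assms(1) by (auto simp: ideal_gen_def)
qed

section \<open>Evaluation of polynomials and forms\<close>

lemma poly_mapping_eq_sum_single:
  "f = (\<Sum>\<mu>\<in>Poly_Mapping.keys f. Poly_Mapping.single \<mu> (Poly_Mapping.lookup f \<mu>))"
  by (rule poly_mapping_eqI)
    (auto simp: lookup_sum lookup_single when_def sum.delta in_keys_iff)

text \<open>
  With one summation range for several polynomials and one range of variables for all monomials,
  additivity and multiplicativity can be read off termwise.
\<close>

lemma mpoly_eval_eq_sum_superset:
  fixes g :: "('v::finite, 'k::comm_ring_1) mpoly" and \<iota> :: "'k \<Rightarrow> 'l::comm_ring_1"
  assumes "\<iota> 0 = 0" "finite S" "Poly_Mapping.keys g \<subseteq> S"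
  shows "mpoly_eval \<iota> x g =
    (\<Sum>\<mu>\<in>S. \<iota> (Poly_Mapping.lookup g \<mu>) * (\<Prod>v\<in>UNIV. x v ^ Poly_Mapping.lookup \<mu> v))"
proof -
  have "(\<Prod>v\<in>Poly_Mapping.keys \<mu>. x v ^ Poly_Mapping.lookup \<mu> v) =
      (\<Prod>v\<in>UNIV. x v ^ Poly_Mapping.lookup \<mu> v)" for \<mu>
    by (rule prod.mono_neutral_left) (auto simp: in_keys_iff)
  then have "mpoly_eval \<iota> x g = (\<Sum>\<mu>\<in>Poly_Mapping.keys g.
      \<iota> (Poly_Mapping.lookup g \<mu>) * (\<Prod>v\<in>UNIV. x v ^ Poly_Mapping.lookup \<mu> v))"
    by (simp add: mpoly_eval_def)
  also have "\<dots> = (\<Sum>\<mu>\<in>S.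
      \<iota> (Poly_Mapping.lookup g \<mu>) * (\<Prod>v\<in>UNIV. x v ^ Poly_Mapping.lookup \<mu> v))"
    using assms by (intro sum.mono_neutral_left) (auto simp: in_keys_iff)
  finally show ?thesis .
qed

lemma comm_ring_hom_mpoly_eval:
  fixes \<iota> :: "'k::comm_ring_1 \<Rightarrow> 'l::comm_ring_1" and x :: "'v::finite \<Rightarrow> 'l"
  assumes "comm_ring_hom \<iota>"
  shows "comm_ring_hom (mpoly_eval \<iota> x)"
proof -
  interpret \<iota>: comm_ring_hom \<iota> by fact
  let ?E = "mpoly_eval \<iota> x"
  define X where "X \<mu> = (\<Prod>v\<in>UNIV. x v ^ Poly_Mapping.lookup \<mu> v)" for \<mu>
  note eval = mpoly_eval_eq_sum_superset[where \<iota> = \<iota> and x = x, OF \<iota>.hom_zero, folded X_def]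
  have add: "?E (f + g) = ?E f + ?E g" for f g
  proof -
    let ?S = "Poly_Mapping.keys f \<union> Poly_Mapping.keys g"
    have "Poly_Mapping.keys (f + g) \<subseteq> ?S"
      by (rule keys_add)
    then show ?thesis
      by (simp add: eval[of ?S] lookup_add \<iota>.hom_add distrib_right sum.distrib)
  qed
  have zero: "?E 0 = 0"
    by (simp add: mpoly_eval_def)
  have sum: "?E (sum h A) = (\<Sum>a\<in>A. ?E (h a))" for h :: "'b \<Rightarrow> ('v, 'k) mpoly" and A
    by (induction A rule: infinite_finite_induct) (simp_all add: add zero)
  have single: "?E (Poly_Mapping.single \<mu> c) = \<iota> c * X \<mu>" for \<mu> c
    by (simp add: eval[of "{\<mu>}"])
  have X_add: "X (\<mu> + \<nu>) = X \<mu> * X \<nu>" for \<mu> \<nu>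
    by (simp add: X_def lookup_add power_add prod.distrib)
  have "?E (f * g) = ?E f * ?E g" for f g
  proof -
    have "f * g = (\<Sum>\<mu>\<in>Poly_Mapping.keys f. \<Sum>\<nu>\<in>Poly_Mapping.keys g.
        Poly_Mapping.single (\<mu> + \<nu>) (Poly_Mapping.lookup f \<mu> * Poly_Mapping.lookup g \<nu>))"
      by (subst (1) poly_mapping_eq_sum_single[of f], subst (1) poly_mapping_eq_sum_single[of g])
        (simp add: sum_product mult_single)
    then have "?E (f * g) = (\<Sum>\<mu>\<in>Poly_Mapping.keys f. \<Sum>\<nu>\<in>Poly_Mapping.keys g.
        (\<iota> (Poly_Mapping.lookup f \<mu>) * X \<mu>) * (\<iota> (Poly_Mapping.lookup g \<nu>) * X \<nu>))"
      by (simp add: sum single X_add \<iota>.hom_mult ac_simps)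
    then show ?thesis
      by (simp add: sum_product[symmetric] eval[OF finite_keys order_refl])
  qed
  moreover have "?E 1 = 1"
    using single[of 0 1] by (simp add: X_def)
  ultimately show ?thesis
    by unfold_locales (simp_all add: add zero)
qed

lemma mpoly_eval_comp_hom:
  assumes "comm_ring_hom h"
  shows "mpoly_eval (\<lambda>c. h (\<iota> c)) (\<lambda>v. h (x v)) g = h (mpoly_eval \<iota> x g)"
proof -
  interpret comm_ring_hom h by fact
  show ?thesis
    by (simp add: mpoly_eval_def hom_distribs)
qed

lemma mono_degree_add: "mono_degree (\<mu> + \<nu>) = mono_degree \<mu> + mono_degree (\<nu> :: 'v::finite \<Rightarrow>\<^sub>0 nat)"
proof -
  have "mono_degree \<mu> = (\<Sum>v\<in>UNIV. Poly_Mapping.lookup \<mu> v)" for \<mu> :: "'v \<Rightarrow>\<^sub>0 nat"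
    unfolding mono_degree_def by (rule sum.mono_neutral_left) (auto simp: in_keys_iff)
  then show ?thesis
    by (simp add: lookup_add sum.distrib)
qed

lemma is_form_zero [simp]: "is_form e 0"
  by (simp add: is_form_def)

lemma is_form_one: "is_form 0 (1 :: ('v, 'k::comm_ring_1) mpoly)"
  by (simp add: is_form_def mono_degree_def)

lemma is_form_add:
  assumes "is_form e g" "is_form e h"
  shows "is_form e (g + h)"
  using assms keys_add[of g h] by (auto simp: is_form_def)

lemma is_form_uminus:
  assumes "is_form e g"
  shows "is_form e (- g :: ('v, 'k::comm_ring_1) mpoly)"
  using assms by (simp add: is_form_def in_keys_iff)

lemma is_form_sum:
  assumes "\<And>a. a \<in> A \<Longrightarrow> is_form e (h a)"
  shows "is_form e (sum h A)"
  using assms by (induction A rule: infinite_finite_induct) (auto intro: is_form_add)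

lemma is_form_mult:
  fixes g h :: "('v::finite, 'k::comm_ring_1) mpoly"
  assumes "is_form e g" "is_form e' h"
  shows "is_form (e + e') (g * h)"
  using assms keys_mult[of g h] by (fastforce simp: is_form_def mono_degree_add)

lemma is_form_prod:
  fixes h :: "'b \<Rightarrow> ('v::finite, 'k::comm_ring_1) mpoly"
  assumes "\<And>a. a \<in> A \<Longrightarrow> is_form (e a) (h a)"
  shows "is_form (sum e A) (prod h A)"
  using assms
  by (induction A rule: infinite_finite_induct) (auto intro: is_form_mult is_form_one)

text \<open>
  The degree of an entry depends on its column only, and each summand of the Leibniz formula takes
  one entry from each column, so all summands have the same degree.
\<close>

lemma is_form_det:
  fixes A :: "('v::finite, 'k::comm_ring_1) mpoly mat"
  assumes A: "A \<in> carrier_mat n n"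
    and entries: "\<And>i j. i < n \<Longrightarrow> j < n \<Longrightarrow> is_form (e j) (A $$ (i, j))"
  shows "is_form (\<Sum>j<n. e j) (det A)"
  unfolding det_def'[OF A]
proof (rule is_form_sum)
  fix p assume "p \<in> {p. p permutes {0..<n}}"
  then have p: "p permutes {0..<n}" by simp
  have "is_form (\<Sum>i = 0..<n. e (p i)) (\<Prod>i = 0..<n. A $$ (i, p i))"
    using permutes_in_image[OF p] by (intro is_form_prod entries) auto
  moreover have "(\<Sum>i = 0..<n. e (p i)) = (\<Sum>j<n. e j)"
    using sum.permute[OF p, of e] by (simp add: comp_def atLeast0LessThan)
  ultimately show "is_form (\<Sum>j<n. e j) (signof p * (\<Prod>i = 0..<n. A $$ (i, p i)))"
    by (cases p rule: sign_cases) (auto intro: is_form_uminus)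
qed

lemma mpoly_eval_scale_form:
  assumes "is_form e g"
  shows "mpoly_eval \<iota> (\<lambda>v. s * x v) g = s ^ nat e * mpoly_eval \<iota> x g"
proof -
  have "(\<Prod>v\<in>Poly_Mapping.keys \<mu>. (s * x v) ^ Poly_Mapping.lookup \<mu> v) =
      s ^ nat e * (\<Prod>v\<in>Poly_Mapping.keys \<mu>. x v ^ Poly_Mapping.lookup \<mu> v)"
    if "\<mu> \<in> Poly_Mapping.keys g" for \<mu>
  proof -
    have "nat e = mono_degree \<mu>"
      using assms that by (auto simp: is_form_def)
    then show ?thesis
      by (simp add: mono_degree_def power_mult_distrib prod.distrib power_sum)
  qed
  then show ?thesis
    by (simp add: mpoly_eval_def sum_distrib_left ac_simps)
qed

section \<open>Forms of bounded degree in an ideal generated by forms\<close>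

lemma comm_ring_hom_const_poly: "comm_ring_hom (\<lambda>a::'l::comm_ring_1. [:a:])"
  by unfold_locales (simp_all add: one_pCons)

text \<open>
  Substituting \<open>x v * T\<close> for each variable records the degree of a form as a power of \<open>T\<close>, so the
  grading can be handled through coefficients in one indeterminate.
\<close>

lemma coeff_mpoly_eval_line:
  assumes "is_form e g"
  shows "coeff (mpoly_eval (\<lambda>c. [:\<iota> c:]) (\<lambda>v. [:0, x v:]) g) k =
    (if k = nat e then mpoly_eval \<iota> x g else 0)"
proof -
  have "(\<lambda>v. [:0, x v:]) = (\<lambda>v. monom 1 1 * [:x v:])"
    by (simp add: monom_altdef)
  then have "mpoly_eval (\<lambda>c. [:\<iota> c:]) (\<lambda>v. [:0, x v:]) g =
      monom 1 1 ^ nat e * [:mpoly_eval \<iota> x g:]"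
    by (simp only: mpoly_eval_scale_form[OF assms] mpoly_eval_comp_hom[OF comm_ring_hom_const_poly])
  then show ?thesis
    by (simp add: monom_power)
qed

text \<open>
  Restrict polynomials to the line through \<open>x\<close>, as polynomials in \<open>T\<close>. A generator of degree at most
  \<open>d\<close> restricts to \<open>0\<close>, and one of larger degree to a multiple of a power of \<open>T\<close> beyond \<open>d\<close>. Being
  without terms of degree at most \<open>d\<close> is preserved under sums and multiples, so it passes to the
  whole ideal, whereas \<open>g\<close> restricts to \<open>g(x) T\<^sup>e\<close> with \<open>e \<le> d\<close>.
\<close>

lemma form_of_degree_le_in_ideal_vanishes:
  fixes \<iota> :: "'k::comm_ring_1 \<Rightarrow> 'l::comm_ring_1" and x :: "'v::finite \<Rightarrow> 'l"
  assumes \<iota>: "comm_ring_hom \<iota>"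
    and gens: "\<And>s. s \<in> S \<Longrightarrow> \<exists>e. is_form e s \<and> (e \<le> d \<longrightarrow> mpoly_eval \<iota> x s = 0)"
    and g: "g \<in> ideal_gen S" "is_form e g" "e \<le> d"
  shows "mpoly_eval \<iota> x g = 0"
proof (cases "e < 0")
  case True
  \<comment> \<open>Here \<open>nat e\<close> is not the degree, and \<open>d\<close> may be negative as well; but then \<open>g = 0\<close>.\<close>
  then have "g = 0"
    using g(2) by (auto simp: is_form_def keys_eq_empty[symmetric] simp del: keys_eq_empty)
  then show ?thesis
    by (simp add: mpoly_eval_def)
next
  case False
  let ?\<phi> = "mpoly_eval (\<lambda>c. [:\<iota> c:]) (\<lambda>v. [:0, x v:])"
  interpret \<iota>: comm_ring_hom \<iota> by fact
  interpret \<phi>: comm_ring_hom ?\<phi>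
    by (rule comm_ring_hom_mpoly_eval, unfold_locales)
      (simp_all add: one_pCons \<iota>.hom_add \<iota>.hom_mult)
  have low: "\<forall>k. int k \<le> d \<longrightarrow> coeff (?\<phi> g) k = 0"
    using g(1)
  proof (induction rule: ideal_gen_induct)
    case (gen s)
    then obtain e' where e': "is_form e' s" "e' \<le> d \<longrightarrow> mpoly_eval \<iota> x s = 0"
      using gens by blast
    show ?case
      using e'(2) by (auto simp: coeff_mpoly_eval_line[OF e'(1)])
  next
    case zero
    then show ?case by simp
  next
    case (add g h)
    then show ?case by (simp add: \<phi>.hom_add)
  next
    case (mult c g)
    then show ?case
      by (auto simp: \<phi>.hom_mult coeff_mult intro!: sum.neutral)
  qed
  then have "coeff (?\<phi> g) (nat e) = 0"
    using False g(3) by simp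
  then show ?thesis
    by (simp add: coeff_mpoly_eval_line[OF g(2)])
qed

lemma ideal_le_ideal_gen_vanishes:
  fixes \<iota> :: "'k::comm_ring_1 \<Rightarrow> 'l::comm_ring_1" and x :: "'v::finite \<Rightarrow> 'l"
  assumes \<iota>: "comm_ring_hom \<iota>"
    and gens: "\<And>s. s \<in> S \<Longrightarrow> \<exists>e. is_form e s \<and> (e \<le> d \<longrightarrow> mpoly_eval \<iota> x s = 0)"
    and g: "g \<in> ideal_le d (ideal_gen S)"
  shows "mpoly_eval \<iota> x g = 0"
proof -
  interpret comm_ring_hom "mpoly_eval \<iota> x"
    by (rule comm_ring_hom_mpoly_eval[OF \<iota>])
  show ?thesis
    using g unfolding ideal_le_def
  proof (induction rule: ideal_gen_induct)
    case (gen s)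
    then show ?case
      using form_of_degree_le_in_ideal_vanishes[OF \<iota> gens] by blast
  qed (simp_all add: hom_add hom_mult)
qed

section \<open>Independent columns and nonzero minors\<close>

text \<open>
  Fewer than \<open>n\<close> linear equations in \<open>n\<close> unknowns have a nonzero solution: padding the system
  with zero rows gives a square matrix of determinant \<open>0\<close>.
\<close>

lemma exists_orthogonal_vec:
  fixes U :: "'a::field vec set"
  assumes "finite U" "U \<subseteq> carrier_vec n" "card U < n"
  shows "\<exists>v\<in>carrier_vec n. v \<noteq> 0\<^sub>v n \<and> (\<forall>u\<in>U. u \<bullet> v = 0)"
proof -
  obtain us where us: "set us = U" "length us = card U"
    using finite_distinct_list[OF assms(1)] distinct_card by metis
  define W where "W = mat n n (\<lambda>(i, j). if i < length us then us ! i $ j else 0)"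
  have W: "W \<in> carrier_mat n n"
    by (simp add: W_def)
  have "(\<Prod>i = 0..<n. W $$ (i, p i)) = 0" if "p permutes {0..<n}" for p
  proof (rule prod_zero)
    \<comment> \<open>Row \<open>card U\<close> is the first padding row.\<close>
    have "p (card U) < n"
      using permutes_in_image[OF that, of "card U"] assms(3) by simp
    then show "\<exists>i\<in>{0..<n}. W $$ (i, p i) = 0"
      using assms(3) us by (intro bexI[of _ "card U"]) (auto simp: W_def)
  qed simp
  then have "det W = 0"
    unfolding det_def'[OF W] by (intro sum.neutral) auto
  then obtain v where v: "v \<in> carrier_vec n" "v \<noteq> 0\<^sub>v n" "W *\<^sub>v v = 0\<^sub>v n"
    using det_0_iff_vec_prod_zero[OF W] by blast
  have "u \<bullet> v = 0" if "u \<in> U" for u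
  proof -
    have "u \<in> set us"
      using that us(1) by simp
    then obtain i where i: "i < length us" "us ! i = u"
      by (auto simp: in_set_conv_nth)
    have u: "dim_vec u = n"
      using that assms(2) by (auto dest: carrier_vecD)
    have "i < n"
      using i us assms(3) by linarith
    have "row W i = u"
      by (rule eq_vecI) (use i u \<open>i < n\<close> in \<open>simp_all add: W_def\<close>)
    moreover have "(W *\<^sub>v v) $ i = 0"
      using v(3) \<open>i < n\<close> by simp
    ultimately show ?thesis
      using \<open>i < n\<close> W by (metis carrier_matD(1) index_mult_mat_vec)
  qed
  then show ?thesis
    using v by blast
qed

lemma bij_betw_pick:
  assumes "finite C"
  shows "bij_betw (pick C) {..<card C} C"
proof -
  have inj: "inj_on (pick C) {..<card C}"
    by (rule strict_mono_on_imp_inj_on) (auto simp: strict_mono_on_def intro: pick_mono_le)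
  moreover have "pick C ` {..<card C} \<subseteq> C"
    by (auto intro: pick_in_set_le)
  ultimately show ?thesis
    using assms by (simp add: bij_betw_def card_image card_subset_eq)
qed

lemma submatrix_carrier:
  assumes "A \<in> carrier_mat m n" "R \<subseteq> {..<m}" "C \<subseteq> {..<n}"
  shows "submatrix A R C \<in> carrier_mat (card R) (card C)"
proof -
  have "{i. i < dim_row A \<and> i \<in> R} = R" "{j. j < dim_col A \<and> j \<in> C} = C"
    using assms by auto
  then show ?thesis
    by (intro carrier_matI) (simp_all only: dim_submatrix)
qed

lemma submatrix_entry:
  assumes "A \<in> carrier_mat m n" "R \<subseteq> {..<m}" "C \<subseteq> {..<n}" "i < card R" "j < card C"
  shows "submatrix A R C $$ (i, j) = A $$ (pick R i, pick C j)"
proof -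
  have "{i. i < dim_row A \<and> i \<in> R} = R" "{j. j < dim_col A \<and> j \<in> C} = C"
    using assms by auto
  then show ?thesis
    using assms by (intro submatrix_index) (simp_all only:)
qed

lemma submatrix_UNIV_carrier:
  assumes "A \<in> carrier_mat m n" "C \<subseteq> {..<n}"
  shows "submatrix A UNIV C \<in> carrier_mat m (card C)"
proof -
  have "{j. j < dim_col A \<and> j \<in> C} = C"
    using assms by auto
  then show ?thesis
    using assms(1) by (intro carrier_matI) (simp_all add: dim_submatrix)
qed

lemma cols_submatrix_UNIV:
  assumes A: "A \<in> carrier_mat m n" and C: "C \<subseteq> {..<n}"
  shows "cols (submatrix A UNIV C) = map (\<lambda>j. col A (pick C j)) [0..<card C]"
proof (rule nth_equalityI)
  have fin: "finite C"
    using C finite_subset by blast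
  note B = submatrix_UNIV_carrier[OF A C]
  show "length (cols (submatrix A UNIV C)) = length (map (\<lambda>j. col A (pick C j)) [0..<card C])"
    using B by simp
  fix j assume "j < length (cols (submatrix A UNIV C))"
  then have j: "j < card C"
    using B by simp
  have "pick C j < n"
    using bij_betwE[OF bij_betw_pick[OF fin]] j C by auto
  then have "col (submatrix A UNIV C) j = col A (pick C j)"
    using A B j by (intro eq_vecI) (auto simp: submatrix_def pick_UNIV)
  then show "cols (submatrix A UNIV C) ! j = map (\<lambda>j. col A (pick C j)) [0..<card C] ! j"
    using B j by simp
qed

lemma
  assumes A: "A \<in> carrier_mat m n" and C: "C \<subseteq> {..<n}"
  shows set_cols_submatrix_UNIV: "set (cols (submatrix A UNIV C)) = col A ` C"
    and distinct_cols_submatrix_UNIV_iff: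
      "distinct (cols (submatrix A UNIV C)) \<longleftrightarrow> inj_on (col A) C"
proof -
  have "finite C"
    using C finite_subset by blast
  then have bij: "bij_betw (pick C) {..<card C} C"
    by (rule bij_betw_pick)
  then show "set (cols (submatrix A UNIV C)) = col A ` C"
    using bij_betw_imp_surj_on[OF bij] image_image[of "col A" "pick C" "{..<card C}"]
    by (simp add: cols_submatrix_UNIV[OF A C] atLeast0LessThan)
  have "inj_on (\<lambda>j. col A (pick C j)) {..<card C} \<longleftrightarrow> inj_on (col A) C"
    using comp_inj_on_iff[OF bij_betw_imp_inj_on[OF bij], of "col A"] bij_betw_imp_surj_on[OF bij]
    by (simp add: comp_def)
  then show "distinct (cols (submatrix A UNIV C)) \<longleftrightarrow> inj_on (col A) C"
    by (simp add: cols_submatrix_UNIV[OF A C] distinct_map atLeast0LessThan)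
qed

lemma (in vec_space) maximal_indpt_cols:
  assumes A: "A \<in> carrier_mat n nc" and T: "T \<subseteq> set (cols A)" "lin_indpt T"
  obtains S where "T \<subseteq> S" "S \<subseteq> set (cols A)" "lin_indpt S" "card S = rank A"
    "set (cols A) \<subseteq> span S"
proof -
  let ?P = "\<lambda>T. T \<subseteq> set (cols A) \<and> lin_indpt T"
  obtain S where S: "maximal S ?P" "T \<subseteq> S"
    using maximal_exists_superset[of "set (cols A)" ?P T] T by auto
  then have S': "S \<subseteq> set (cols A)" "lin_indpt S"
    by (simp_all add: maximal_def)
  have carr: "set (cols A) \<subseteq> carrier_vec n"
    using A cols_dim by blast
  have "s \<in> span S" if "s \<in> set (cols A)" for s
  proof (rule ccontr)
    assume s: "s \<notin> span S"
    have "s \<notin> S"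
      using s S' carr span_mem[of S s] by blast
    have "lin_indpt (S \<union> {s})"
      using lin_dep_iff_in_span[of S s] s S' carr that \<open>s \<notin> S\<close> by auto
    then have "S \<union> {s} = S"
      using S(1) S' that unfolding maximal_def by blast
    then show False
      using \<open>s \<notin> S\<close> by blast
  qed
  then show ?thesis
    using that[of S] S S' rank_card_indpt[OF A S(1)] by auto
qed

lemma (in vec_space) exists_basis_of_cols:
  assumes A: "A \<in> carrier_mat n nc"
  obtains S where "S \<subseteq> set (cols A)" "lin_indpt S" "card S = rank A" "set (cols A) \<subseteq> span S"
proof -
  have "lin_indpt {}"
    by (rule finite_lin_indpt2) simp_all
  then show ?thesis
    using maximal_indpt_cols[OF A empty_subsetI] that by metis
qed

lemma obtain_inj_on_preimage:
  assumes "S \<subseteq> f ` D"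
  obtains C where "C \<subseteq> D" "inj_on f C" "f ` C = S"
  using assms by (metis subset_image_inj)

lemma (in vec_space) rank_submatrix_UNIV_indpt_cols:
  assumes "A \<in> carrier_mat n nc" "C \<subseteq> {..<nc}" "inj_on (col A) C" "lin_indpt (col A ` C)"
  shows "rank (submatrix A UNIV C) = card C"
  using lin_indpt_full_rank[OF submatrix_UNIV_carrier[OF assms(1,2)]] assms
  by (simp add: set_cols_submatrix_UNIV distinct_cols_submatrix_UNIV_iff)

lemma (in vec_space) kernel_trivial_if_indpt_cols:
  assumes "A \<in> carrier_mat n nc" "distinct (cols A)" "lin_indpt (set (cols A))"
    and "v \<in> carrier_vec nc" "A *\<^sub>v v = 0\<^sub>v n"
  shows "v = 0\<^sub>v nc"
  using lin_depI[OF assms(1,4) _ assms(5,2)] assms(3) by blast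

text \<open>
  This is the inequality between column rank and row rank. A basis \<open>U\<close> of the row space has at least
  \<open>t\<close> elements: otherwise a nonzero vector is orthogonal to \<open>U\<close>, hence to all rows, and it is a
  linear relation between the columns. The rows in \<open>U\<close> form the required minor.
\<close>

lemma (in vec_space) exists_nonzero_maximal_minor:
  fixes A :: "'a mat"
  assumes A: "A \<in> carrier_mat n t" and indpt: "distinct (cols A)" "lin_indpt (set (cols A))"
  shows "\<exists>R\<subseteq>{..<n}. card R = t \<and> det (submatrix A R UNIV) \<noteq> 0"
proof -
  interpret row: vec_space "TYPE('a)" t .
  have At: "A\<^sup>T \<in> carrier_mat t n"
    using A by simp
  obtain U where U: "U \<subseteq> set (cols A\<^sup>T)" "row.lin_indpt U" "card U = row.rank A\<^sup>T"
      "set (cols A\<^sup>T) \<subseteq> row.span U"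
    by (rule row.exists_basis_of_cols[OF At])
  have U_carr: "U \<subseteq> carrier_vec t"
    using U(1) At cols_dim by blast
  have fin: "finite U"
    using U(1) finite_subset by blast
  have "\<not> card U < t"
  proof
    assume "card U < t"
    then obtain v where v: "v \<in> carrier_vec t" "v \<noteq> 0\<^sub>v t" "\<forall>u\<in>U. u \<bullet> v = 0"
      using exists_orthogonal_vec[OF fin U_carr] by blast
    then have "v \<in> row.orthogonal_complement U"
      using U_carr comm_scalar_prod[OF v(1)] by (auto simp: row.orthogonal_complement_def)
    then have "v \<in> row.orthogonal_complement (row.span U)"
      using row.in_orthogonal_complement_span[OF U_carr] by simp
    then have orth: "v \<bullet> w = 0" if "w \<in> set (cols A\<^sup>T)" for w
      using that U(4) by (auto simp: row.orthogonal_complement_def)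
    have "A *\<^sub>v v = 0\<^sub>v n"
    proof (rule eq_vecI)
      fix i assume "i < dim_vec (0\<^sub>v n :: 'a vec)"
      then have i: "i < n" by simp
      have "row A i \<in> set (cols A\<^sup>T)"
        using i A by (auto simp: in_set_conv_nth rows_def)
      then show "(A *\<^sub>v v) $ i = 0\<^sub>v n $ i"
        using i A orth comm_scalar_prod[OF v(1), of "row A i"] by auto
    qed (use A in simp)
    then show False
      using kernel_trivial_if_indpt_cols[OF A indpt v(1)] v(2) by blast
  qed
  moreover have "card U \<le> t"
    using row.li_le_dim(2)[OF row.fin_dim _ U(2)] U_carr by (simp add: row.dim_is_n)
  ultimately have "card U = t" by simp
  have "U \<subseteq> col A\<^sup>T ` {..<n}"
    using U(1) At by (auto simp: cols_def)
  then obtain R where R: "R \<subseteq> {..<n}" "inj_on (col A\<^sup>T) R" "col A\<^sup>T ` R = U"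
    by (rule obtain_inj_on_preimage)
  have cR: "card R = t"
    using R card_image \<open>card U = t\<close> by metis
  have "row.rank (submatrix A\<^sup>T UNIV R) = t"
    using row.rank_submatrix_UNIV_indpt_cols[OF At R(1,2)] R U cR by simp
  moreover have sq: "submatrix A\<^sup>T UNIV R \<in> carrier_mat t t"
    using submatrix_UNIV_carrier[OF At R(1)] cR by simp
  ultimately have "det (submatrix A\<^sup>T UNIV R) \<noteq> 0"
    using row.det_rank_iff by blast
  moreover have "submatrix A R UNIV = (submatrix A\<^sup>T UNIV R)\<^sup>T"
    using A R(1) by (intro eq_matI) (auto simp: submatrix_def pick_UNIV pick_le)
  ultimately show ?thesis
    using R(1) cR det_transpose[OF sq] by auto
qed

lemma (in vec_space) exists_nonzero_minor_iff_indpt_cols: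
  fixes A :: "'a mat"
  assumes A: "A \<in> carrier_mat n nc" and C: "C \<subseteq> {..<nc}"
  shows "(\<exists>R\<subseteq>{..<n}. card R = card C \<and> det (submatrix A R C) \<noteq> 0) \<longleftrightarrow>
    inj_on (col A) C \<and> lin_indpt (col A ` C)"
    (is "?minor \<longleftrightarrow> ?indpt")
proof
  let ?B = "submatrix A UNIV C"
  note B = submatrix_UNIV_carrier[OF A C]
  note cols_B = set_cols_submatrix_UNIV[OF A C] distinct_cols_submatrix_UNIV_iff[OF A C]
  show ?indpt if ?minor
  proof -
    from that obtain R where R: "R \<subseteq> {..<n}" "card R = card C" "det (submatrix ?B R UNIV) \<noteq> 0"
      unfolding submatrix_split[of A _ C, symmetric] by blast
    then have "card C \<le> rank ?B"
      using rank_gt_minor[OF B R(3)] by simp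
    then have full: "rank ?B = card C"
      using rank_le_nc[OF B] by simp
    have "distinct (cols ?B)"
    proof (rule ccontr)
      assume "\<not> distinct (cols ?B)"
      then have "card (set (cols ?B)) < card C"
        using carrier_matD(2)[OF B] card_distinct[of "cols ?B"] card_length[of "cols ?B"]
        by (auto simp: less_le)
      moreover obtain S where "S \<subseteq> set (cols ?B)" "card S = rank ?B"
        by (rule exists_basis_of_cols[OF B])
      ultimately show False
        using card_mono[of "set (cols ?B)" S] full by simp
    qed
    then show ?indpt
      using full_rank_lin_indpt[OF B full] cols_B by simp
  qed
  show ?minor if ?indpt
    using that exists_nonzero_maximal_minor[OF B, unfolded cols_B]
    unfolding submatrix_split[of A _ C, symmetric] by blast
qed

section \<open>Minors with prescribed use of the first columns\<close>

lemma first_columns_carrier: "A \<in> carrier_mat m n \<Longrightarrow> first_columns a A \<in> carrier_mat m a"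
  by (simp add: first_columns_def)

lemma set_cols_first_columns:
  assumes A: "A \<in> carrier_mat m n" and "a \<le> n"
  shows "set (cols (first_columns a A)) = col A ` {..<a}"
proof -
  have "col (first_columns a A) j = col A j" if "j < a" for j
    using that assms by (intro eq_vecI) (auto simp: first_columns_def)
  then show ?thesis
    using first_columns_carrier[OF A, of a] by (auto simp: cols_def)
qed

text \<open>
  By the previous characterisation of nonzero minors, the question is which sets of independent
  columns exist. A minor with enough of the first columns gives independent columns of both
  matrices; in the other direction \<open>r\<close> independent ones among the first columns are extended to \<open>t\<close>
  inside a basis of the column space, which is possible as \<open>r \<le> t\<close>.
\<close>

lemma (in vec_space) minors_with_first_columns_vanish_iff:
  fixes A :: "'a mat" and r :: int
  assumes A: "A \<in> carrier_mat n nc" and "a \<le> nc" and "r \<le> int t"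
  shows "(\<forall>R C. R \<subseteq> {..<n} \<and> C \<subseteq> {..<nc} \<and> card R = t \<and> card C = t \<and> r \<le> int (card (C \<inter> {..<a}))
      \<longrightarrow> det (submatrix A R C) = 0) \<longleftrightarrow>
    rank A < t \<or> int (rank (first_columns a A)) < r"
    (is "?vanish \<longleftrightarrow> ?low")
proof
  let ?A' = "first_columns a A"
  note A' = first_columns_carrier[OF A, of a]
  have cols_A: "set (cols A) = col A ` {..<nc}"
    using A by (auto simp: cols_def)
  have cols_A': "set (cols ?A') = col A ` {..<a}"
    by (rule set_cols_first_columns[OF A \<open>a \<le> nc\<close>])
  show ?vanish if low: ?low
  proof (intro allI impI, rule ccontr)
    fix R C
    assume RC: "R \<subseteq> {..<n} \<and> C \<subseteq> {..<nc} \<and> card R = t \<and> card C = t \<and> r \<le> int (card (C \<inter> {..<a}))"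
      and "det (submatrix A R C) \<noteq> 0"
    then have C: "inj_on (col A) C" "lin_indpt (col A ` C)"
      using exists_nonzero_minor_iff_indpt_cols[OF A, of C] by auto
    have "card (col A ` C) \<le> rank A"
      using RC C(2) by (intro rank_ge_card_indpt[OF A]) (auto simp: cols_A)
    then have "t \<le> rank A"
      using RC C(1) by (simp add: card_image)
    moreover have "card (col A ` (C \<inter> {..<a})) \<le> rank ?A'"
      using subset_li_is_li[OF C(2), of "col A ` (C \<inter> {..<a})"]
      by (intro rank_ge_card_indpt[OF A']) (auto simp: cols_A')
    then have "card (C \<inter> {..<a}) \<le> rank ?A'"
      using C(1) by (simp add: card_image inj_on_Int)
    ultimately show False
      using low RC by linarith
  qed
  show ?low if vanish: ?vanish
  proof (rule ccontr)
    assume "\<not> ?low"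
    then have ranks: "t \<le> rank A" "nat r \<le> rank ?A'" by auto
    \<comment> \<open>Build \<open>T' \<subseteq> T\<close> with \<open>T'\<close> among the first columns, \<open>card T' = nat r\<close> and \<open>card T = t\<close>.\<close>
    obtain S' where S': "S' \<subseteq> set (cols ?A')" "lin_indpt S'" "card S' = rank ?A'"
      by (rule exists_basis_of_cols[OF A'])
    obtain T' where T': "T' \<subseteq> S'" "card T' = nat r"
      using ranks(2) S'(3) obtain_subset_with_card_n by metis
    have "S' \<subseteq> set (cols A)"
      using S'(1) \<open>a \<le> nc\<close> unfolding cols_A cols_A' by auto
    then obtain S where S: "S' \<subseteq> S" "S \<subseteq> set (cols A)" "lin_indpt S" "card S = rank A"
      using maximal_indpt_cols[OF A _ S'(2)] by metis
    have "finite S"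
      using S(2) finite_subset by blast
    moreover have "card T' \<le> t" "t \<le> card S" "T' \<subseteq> S"
      using T' S(1,4) ranks(1) \<open>r \<le> int t\<close> by auto
    ultimately obtain T where T: "T' \<subseteq> T" "T \<subseteq> S" "card T = t"
      using exists_subset_between[of T' t S] by blast
    \<comment> \<open>Equal columns may occur on both sides of \<open>a\<close>: the indices for \<open>T'\<close> are chosen below \<open>a\<close>.\<close>
    have "T' \<subseteq> col A ` {..<a}"
      using T'(1) S'(1) cols_A' by blast
    then obtain C' where C': "C' \<subseteq> {..<a}" "inj_on (col A) C'" "col A ` C' = T'"
      by (rule obtain_inj_on_preimage)
    have "T - T' \<subseteq> col A ` {..<nc}"
      using T(2) S(2) cols_A by blast
    then obtain D where D: "D \<subseteq> {..<nc}" "inj_on (col A) D" "col A ` D = T - T'"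
      by (rule obtain_inj_on_preimage)
    let ?C = "C' \<union> D"
    have C: "?C \<subseteq> {..<nc}"
      using C'(1) D(1) \<open>a \<le> nc\<close> by auto
    have inj: "inj_on (col A) ?C"
      using C'(2,3) D(2,3) by (auto simp: inj_on_Un)
    have img: "col A ` ?C = T"
      using C'(3) D(3) T(1) by auto
    have card: "card ?C = t"
      using card_image[OF inj] img T(3) by simp
    have "lin_indpt (col A ` ?C)"
      using subset_li_is_li[OF S(3) T(2)] img by simp
    then obtain R where R: "R \<subseteq> {..<n}" "card R = t" "det (submatrix A R ?C) \<noteq> 0"
      using exists_nonzero_minor_iff_indpt_cols[OF A C] inj card by auto
    have "card C' = nat r"
      using card_image[OF C'(2)] C'(3) T'(2) by simp
    moreover have "card C' \<le> card (?C \<inter> {..<a})"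
      using C'(1) by (intro card_mono) auto
    ultimately have "r \<le> int (card (?C \<inter> {..<a}))" by linarith
    then show False
      using vanish R C card by blast
  qed
qed

lemma (in vec_space) rank_less_iff_minors_vanish:
  fixes A :: "'a mat"
  assumes A: "A \<in> carrier_mat n nc"
  shows "rank A < t \<longleftrightarrow>
    (\<forall>R C. R \<subseteq> {..<n} \<and> C \<subseteq> {..<nc} \<and> card R = t \<and> card C = t \<longrightarrow> det (submatrix A R C) = 0)"
  using minors_with_first_columns_vanish_iff[OF A, of 0 0 t] by simp

section \<open>Fibres of bundle maps\<close>

lemma submatrix_map_mat: "submatrix (map_mat h A) R C = map_mat h (submatrix A R C)"
  by (intro eq_matI) (auto simp: submatrix_def pick_le)

lemma mpoly_eval_minor:
  fixes \<iota> :: "'k::field \<Rightarrow> 'l::field" and f :: "('v::finite, 'k) mpoly mat"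
  assumes "comm_ring_hom \<iota>"
  shows "mpoly_eval \<iota> x (det (submatrix f R C)) = det (submatrix (fibre_map \<iota> f x) R C)"
proof -
  interpret comm_ring_hom "mpoly_eval \<iota> x"
    by (rule comm_ring_hom_mpoly_eval[OF assms])
  show ?thesis
    by (simp add: fibre_map_def submatrix_map_mat)
qed

lemma is_form_minor:
  fixes f :: "('v::finite, 'k::field) mpoly mat"
  assumes f: "f \<in> bundle_maps m n a p q"
    and R: "R \<subseteq> {..<m}" "card R = t" and C: "C \<subseteq> {..<n}" "card C = t"
  shows "is_form (int t * q - int (card (C \<inter> {..<a})) * (q - p)) (det (submatrix f R C))"
proof -
  define e where "e j = (if j < a then p else q)" for j
  have f_carr: "f \<in> carrier_mat m n"
    using f by (simp add: bundle_maps_def)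
  have fin: "finite R" "finite C"
    using R(1) C(1) finite_subset by blast+
  note bij = bij_betw_pick[OF fin(1)] bij_betw_pick[OF fin(2)]
  have "submatrix f R C \<in> carrier_mat t t"
    using submatrix_carrier[OF f_carr R(1) C(1)] R C by simp
  moreover have "is_form (e (pick C j)) (submatrix f R C $$ (i, j))" if "i < t" "j < t" for i j
  proof -
    have "pick R i < m" "pick C j < n"
      using that R C bij_betwE[OF bij(1)] bij_betwE[OF bij(2)] by auto
    then show ?thesis
      using that R C f by (simp add: submatrix_entry[OF f_carr R(1) C(1)] bundle_maps_def e_def)
  qed
  ultimately have "is_form (\<Sum>j<t. e (pick C j)) (det (submatrix f R C))"
    by (rule is_form_det)
  also have "(\<Sum>j<t. e (pick C j)) = (\<Sum>j\<in>C. e j)"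
    using sum.reindex_bij_betw[OF bij(2), of e] C(2) by simp
  also have "\<dots> = (\<Sum>j\<in>C. q - (if j \<in> {..<a} then q - p else 0))"
    by (intro sum.cong) (auto simp: e_def)
  also have "\<dots> = int t * q - int (card (C \<inter> {..<a})) * (q - p)"
    using fin(2) C(2) by (simp add: sum_subtractf sum.If_cases lessThan_def)
  finally show ?thesis .
qed

lemma bundle_maps_carrier: "f \<in> bundle_maps m n a p q \<Longrightarrow> f \<in> carrier_mat m n"
  by (simp add: bundle_maps_def)

lemma fibre_map_carrier: "f \<in> carrier_mat m n \<Longrightarrow> fibre_map \<iota> f x \<in> carrier_mat m n"
  by (simp add: fibre_map_def)

lemma first_columns_bundle_maps:
  assumes "f \<in> bundle_maps m n a p q" "a \<le> n"
  shows "first_columns a f \<in> bundle_maps m a a p q"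
proof -
  have entries: "is_form (if j < a then p else q) (f $$ (i, j))" if "i < m" "j < n" for i j
    using assms(1) that by (simp add: bundle_maps_def)
  have "is_form p (f $$ (i, j))" if "i < m" "j < a" for i j
    using entries[of i j] that assms(2) by simp
  then show ?thesis
    using bundle_maps_carrier[OF assms(1)] by (simp add: bundle_maps_def first_columns_def)
qed

lemma fibre_map_first_columns:
  assumes "f \<in> carrier_mat m n" "a \<le> n"
  shows "fibre_map \<iota> (first_columns a f) x = first_columns a (fibre_map \<iota> f x)"
  using assms by (intro eq_matI) (auto simp: fibre_map_def first_columns_def)

text \<open>
  Ranks are determined by which minors vanish, and a minor, being a form, is multiplied by a power
  of \<open>c\<close>.
\<close>

lemma rank_fibre_map_scale:
  fixes \<iota> :: "'k::field \<Rightarrow> 'l::field" and f :: "('v::finite, 'k) mpoly mat"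
  assumes \<iota>: "comm_ring_hom \<iota>" and f: "f \<in> bundle_maps m n a p q" and c: "c \<noteq> 0"
  shows "vec_space.rank m (fibre_map \<iota> f (\<lambda>v. c * x v)) = vec_space.rank m (fibre_map \<iota> f x)"
proof -
  note carr = fibre_map_carrier[OF bundle_maps_carrier[OF f], of \<iota>]
  have "det (submatrix (fibre_map \<iota> f (\<lambda>v. c * x v)) R C) = 0 \<longleftrightarrow>
      det (submatrix (fibre_map \<iota> f x) R C) = 0"
    if "R \<subseteq> {..<m}" "C \<subseteq> {..<n}" "card R = t" "card C = t" for R C t
    using mpoly_eval_scale_form[OF is_form_minor[OF f that(1,3,2,4)], of \<iota> c x] c
    by (simp add: mpoly_eval_minor[OF \<iota>])
  then have "vec_space.rank m (fibre_map \<iota> f (\<lambda>v. c * x v)) < t \<longleftrightarrow>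
      vec_space.rank m (fibre_map \<iota> f x) < t" for t
    unfolding vec_space.rank_less_iff_minors_vanish[OF carr] by blast
  then show ?thesis
    by (metis linorder_neqE_nat less_irrefl)
qed

text \<open>
  The bound \<open>r\<close> enters through the equivalence \<open>degree\<close>, which compares numbers of columns with
  degrees of minors, rather than through the ceiling; this keeps division out of the argument.
\<close>

lemma ideal_le_minor_ideal_vanishes_iff:
  fixes \<iota> :: "'k::field \<Rightarrow> 'l::field" and f :: "('v::finite, 'k) mpoly mat"
  assumes \<iota>: "comm_ring_hom \<iota>" and f: "f \<in> bundle_maps m n a p q" and "a \<le> n"
    and degree: "\<And>c. r \<le> int c \<longleftrightarrow> int t * q - int c * (q - p) \<le> d"
    and "r \<le> int t"
  shows "(\<forall>g\<in>ideal_le d (minor_ideal t f). mpoly_eval \<iota> x g = 0) \<longleftrightarrow>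
    vec_space.rank m (fibre_map \<iota> f x) < t \<or>
    int (vec_space.rank m (fibre_map \<iota> (first_columns a f) x)) < r"
proof -
  note f_carr = bundle_maps_carrier[OF f]
  let ?minor = "\<lambda>R C. R \<subseteq> {..<m} \<and> C \<subseteq> {..<n} \<and> card R = t \<and> card C = t"
  have minors: "minors t f = {det (submatrix f R C) | R C. ?minor R C}"
    using f_carr by (simp add: minors_def)
  have "(\<forall>g\<in>ideal_le d (minor_ideal t f). mpoly_eval \<iota> x g = 0) \<longleftrightarrow>
      (\<forall>R C. R \<subseteq> {..<m} \<and> C \<subseteq> {..<n} \<and> card R = t \<and> card C = t \<and> r \<le> int (card (C \<inter> {..<a}))
        \<longrightarrow> mpoly_eval \<iota> x (det (submatrix f R C)) = 0)"
    (is "?ideal \<longleftrightarrow> ?minors")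
  proof
    assume ideal: ?ideal
    show ?minors
    proof (intro allI impI)
      fix R C
      assume RC: "R \<subseteq> {..<m} \<and> C \<subseteq> {..<n} \<and> card R = t \<and> card C = t \<and> r \<le> int (card (C \<inter> {..<a}))"
      then have "det (submatrix f R C) \<in> minor_ideal t f"
        using subset_ideal_gen[of "minors t f"] unfolding minor_ideal_def minors by blast
      moreover have "\<exists>e\<le>d. is_form e (det (submatrix f R C))"
        using RC is_form_minor[OF f, of R t C] degree[of "card (C \<inter> {..<a})"] by auto
      ultimately have "det (submatrix f R C) \<in> ideal_le d (minor_ideal t f)"
        unfolding ideal_le_def by (intro subsetD[OF subset_ideal_gen]) simp
      then show "mpoly_eval \<iota> x (det (submatrix f R C)) = 0"
        using ideal by blast
    qed
  next
    assume vanish: ?minors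
    have "\<exists>e. is_form e s \<and> (e \<le> d \<longrightarrow> mpoly_eval \<iota> x s = 0)" if "s \<in> minors t f" for s
    proof -
      from that obtain R C where s: "s = det (submatrix f R C)" and RC: "?minor R C"
        unfolding minors by blast
      show ?thesis
        unfolding s using RC vanish degree[of "card (C \<inter> {..<a})"]
        by (intro exI[of _ "int t * q - int (card (C \<inter> {..<a})) * (q - p)"])
          (simp add: is_form_minor[OF f])
    qed
    then show ?ideal
      using ideal_le_ideal_gen_vanishes[OF \<iota>] unfolding minor_ideal_def by blast
  qed
  also have "\<dots> \<longleftrightarrow> vec_space.rank m (fibre_map \<iota> f x) < t \<or>
      int (vec_space.rank m (fibre_map \<iota> (first_columns a f) x)) < r"
    using vec_space.minors_with_first_columns_vanish_iff
      [OF fibre_map_carrier[OF f_carr] \<open>a \<le> n\<close> \<open>r \<le> int t\<close>, of \<iota> x]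
    by (simp add: mpoly_eval_minor[OF \<iota>] fibre_map_first_columns[OF f_carr \<open>a \<le> n\<close>])
  finally show ?thesis .
qed

section \<open>The loci in projective space\<close>

lemma vanishing_locus_ideal_le_minor_ideal:
  fixes \<iota> :: "'k::field \<Rightarrow> 'l::field" and f :: "('v::finite, 'k) mpoly mat"
  assumes \<iota>: "comm_ring_hom \<iota>" and f: "f \<in> bundle_maps m n a p q" and "a \<le> n"
    and degree: "\<And>c. r \<le> int c \<longleftrightarrow> int t * q - int c * (q - p) \<le> d"
    and "r \<le> int t"
  shows "vanishing_locus \<iota> (ideal_le d (minor_ideal t f)) =
    degeneracy_locus \<iota> (int t) f \<union> degeneracy_locus \<iota> r (first_columns a f)"
proof (rule Set.set_eqI)
  fix X :: "('v \<Rightarrow> 'l) set"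
  note f' = first_columns_bundle_maps[OF f \<open>a \<le> n\<close>]
  have dims: "dim_row f = m" "dim_row (first_columns a f) = m"
    using bundle_maps_carrier[OF f] bundle_maps_carrier[OF f'] by auto
  show "X \<in> vanishing_locus \<iota> (ideal_le d (minor_ideal t f)) \<longleftrightarrow>
      X \<in> degeneracy_locus \<iota> (int t) f \<union> degeneracy_locus \<iota> r (first_columns a f)"
  proof (cases "X \<in> proj_space")
    case True
    then obtain x where X: "X = {(\<lambda>v. c * x v) | c. c \<noteq> 0}"
      unfolding proj_space_def by blast
    have "x \<in> X"
      unfolding X by (auto intro!: exI[of _ 1])
    \<comment> \<open>The alternative \<open>?R y < t \<or> ?R' y < r\<close> does not depend on the representative \<open>y\<close>, which
      lets the quantifier over \<open>X\<close> be distributed over the disjunction.\<close>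
    let ?R = "\<lambda>y. vec_space.rank m (fibre_map \<iota> f y)"
    let ?R' = "\<lambda>y. vec_space.rank m (fibre_map \<iota> (first_columns a f) y)"
    have const: "?R y = ?R x" "?R' y = ?R' x" if "y \<in> X" for y
      using that rank_fibre_map_scale[OF \<iota> f] rank_fibre_map_scale[OF \<iota> f'] unfolding X by auto
    have "X \<in> vanishing_locus \<iota> (ideal_le d (minor_ideal t f)) \<longleftrightarrow>
        (\<forall>y\<in>X. \<forall>g\<in>ideal_le d (minor_ideal t f). mpoly_eval \<iota> y g = 0)"
      using True by (simp add: vanishing_locus_def)
    also have "\<dots> \<longleftrightarrow> (\<forall>y\<in>X. ?R y < t \<or> int (?R' y) < r)"
      by (simp only: ideal_le_minor_ideal_vanishes_iff[OF assms])
    also have "\<dots> \<longleftrightarrow> ?R x < t \<or> int (?R' x) < r"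
      using const \<open>x \<in> X\<close> by metis
    also have "\<dots> \<longleftrightarrow> (\<forall>y\<in>X. int (?R y) < int t) \<or> (\<forall>y\<in>X. int (?R' y) < r)"
      using const \<open>x \<in> X\<close> by (metis of_nat_less_iff)
    also have "\<dots> \<longleftrightarrow>
        X \<in> degeneracy_locus \<iota> (int t) f \<union> degeneracy_locus \<iota> r (first_columns a f)"
      using True by (simp add: degeneracy_locus_def dims)
    finally show ?thesis .
  qed (simp add: vanishing_locus_def degeneracy_locus_def)
qed

text \<open>The whole space is open, as the locus where the constant \<open>1\<close> does not vanish.\<close>

lemma for_general_if_all:
  assumes "V \<noteq> {}" "\<And>f. f \<in> V \<Longrightarrow> P f"
  shows "for_general V P"
proof -
  have "mpoly_eval id (coeff_coords f) 1 \<noteq> 0" for f :: "('v, 'k::field) mpoly mat"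
    by (simp add: mpoly_eval_def)
  then have "zariski_open_in V V"
    unfolding zariski_open_in_def by (intro exI[of _ "{1}"]) auto
  then show ?thesis
    using assms unfolding for_general_def by blast
qed

theorem corollary1p3:
  fixes \<iota> :: "'k::field \<Rightarrow> 'l::field"
    and p q d r :: int and m n a t :: nat
  assumes "field_hom \<iota>"
    and "p < q" and "a \<le> n"
    and "int t * p \<le> d"
    and "r = \<lceil>real_of_int (int t * q - d) / real_of_int (q - p)\<rceil>"
  shows "for_general (bundle_maps m n a p q :: ('v::finite, 'k) mpoly mat set)
    (\<lambda>f. vanishing_locus \<iota> (ideal_le d (minor_ideal t f)) =
         degeneracy_locus \<iota> (int t) f \<union> degeneracy_locus \<iota> r (first_columns a f))"
proof (rule for_general_if_all)
  have "0\<^sub>m m n \<in> (bundle_maps m n a p q :: ('v, 'k) mpoly mat set)"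
    by (simp add: bundle_maps_def)
  then show "(bundle_maps m n a p q :: ('v, 'k) mpoly mat set) \<noteq> {}"
    by blast
next
  fix f :: "('v, 'k) mpoly mat"
  assume f: "f \<in> bundle_maps m n a p q"
  interpret field_hom \<iota> by fact
  have degree: "r \<le> int c \<longleftrightarrow> int t * q - int c * (q - p) \<le> d" for c
  proof -
    have "r \<le> int c \<longleftrightarrow> real_of_int (int t * q - d) \<le> real_of_int (int c) * real_of_int (q - p)"
      using assms(2,5) by (simp add: ceiling_le_iff divide_le_eq)
    also have "\<dots> \<longleftrightarrow> int t * q - d \<le> int c * (q - p)"
      by (simp only: of_int_mult[symmetric] of_int_le_iff)
    finally show ?thesis by linarith
  qed
  have "r \<le> int t"
    unfolding degree using assms(4) by (simp add: algebra_simps)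
  then show "vanishing_locus \<iota> (ideal_le d (minor_ideal t f)) =
      degeneracy_locus \<iota> (int t) f \<union> degeneracy_locus \<iota> r (first_columns a f)"
    using vanishing_locus_ideal_le_minor_ideal[OF _ f assms(3) degree] comm_ring_hom_axioms
    by blast
qed

end
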